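(* Let $N\ge 1$ be an integer and let $\{Q_k\}_{k=0}^{2N}$ be a finite set of Laurent polynomials of the form $$Q_{2n}(x)=\sum_{j=-n}^{n}\alpha_j^{(2n)}x^j,\quad \alpha_n^{(2n)}\neq 0\qquad(0\le n\le N),$$ $$Q_{2n+1}(x)=\sum_{j=-n-1}^{n}\alpha_j^{(2n+1)}x^j,\quad \alpha_{-n-1}^{(2n+1)}\neq 0\qquad(0\le n\le N-1),$$ with complex coefficients. Put $Q_{-1}(x):=0$ and suppose that there are complex numbers $g_k,f_k$ $(1\le k\le 2N)$ with $f_{2n+1}\neq 0$, $f_{2n+2}\neq 0$ such that for all $n=0,1,\dots,N-1$ $$Q_{2n+1}(x)=(x^{-1}+g_{2n+1})Q_{2n}(x)+f_{2n+1}Q_{2n-1}(x),$$ $$Q_{2n+2}(x)=(1+g_{2n+2}x)Q_{2n+1}(x)+f_{2n+2}Q_{2n}(x).$$ Let $L:\mathcal{A}\to\mathbb{C}$ be a linear functional such that, for all $k,m\in\{0,1,\dots,2N\}$, $L(Q_kQ_m)=0$ if $k\neq m$ and $L(Q_kQ_m)\neq 0$ if $k=m$, and let $L_N$ be the restriction of $L$ to $\mathcal{A}_N$. Suppose that $$a:=L_N(x^{-N})\neq 0.$$ Then $L_N$ admits the integral representation $$L_N(Q)=\int_{\mathbb{C}} Q(z)\,a\,z^{N}\,d\mu(z),\qquad Q\in\mathcal{A}_N,$$ where $\mu$ is a finitely atomic positive measure on the Borel subsets of $\mathbb{C}$.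
   Context: $\mathcal{A}$ denotes the complex vector space (algebra) of all Laurent polynomials in one indeterminate $x$ with complex coefficients. $\mathcal{A}_N$ denotes the subspace of all Laurent polynomials of the form $\sum_{j=-N}^{N}\lambda_j x^j$, $\lambda_j\in\mathbb{C}$. For $Q\in\mathcal{A}_N$, the product $Q(z)z^N$ in the integrand is understood as a polynomial in $z$. A finitely atomic positive measure is a finite sum of point masses with positive weights. The measure $\mu$ does not depend on $Q$. *)

theory Defs
  imports "HOL-Analysis.Analysis" "HOL-Library.Poly_Mapping"
    "HOL-Computational_Algebra.Polynomial"
begin

text \<open>
  Finitely supported maps from the additive group of integers to the complex numbers, with
  convolution as multiplication, form the algebra of complex Laurent polynomials:
  \<open>Poly_Mapping.single j c\<close> is the monomial $c x^j$.
\<close>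

type_synonym laurent = "int \<Rightarrow>\<^sub>0 complex"

abbreviation laurent_const :: "complex \<Rightarrow> laurent" where
  "laurent_const c \<equiv> Poly_Mapping.single 0 c"

abbreviation laurent_X_powi :: "int \<Rightarrow> laurent" where
  "laurent_X_powi j \<equiv> Poly_Mapping.single j 1"

definition laurent_scale :: "complex \<Rightarrow> laurent \<Rightarrow> laurent" where
  "laurent_scale c P = laurent_const c * P"

lemma vector_space_laurent_scale: "vector_space laurent_scale"
  by unfold_locales
    (simp_all add: laurent_scale_def algebra_simps single_add mult_single flip: mult.assoc)

definition laurent_upto :: "nat \<Rightarrow> laurent set" where
  "laurent_upto N =
     range (\<lambda>c. \<Sum>j = - int N..int N. laurent_scale (c j) (laurent_X_powi j))"

text \<open>
  The product $P(z) z^N$ as a polynomial in $z$. It is meaningful for \<open>P \<in> laurent_upto N\<close>,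
  where the exponents \<open>j + int N\<close> are nonnegative; its value at \<open>0\<close> is then the constant
  coefficient of this polynomial, i.e. the coefficient of $x^{-N}$ in $P$.
\<close>

definition laurent_shift_poly :: "nat \<Rightarrow> laurent \<Rightarrow> complex poly" where
  "laurent_shift_poly N P =
     (\<Sum>j\<in>Poly_Mapping.keys P. monom (Poly_Mapping.lookup P j) (nat (j + int N)))"

lemma keys_laurent_upto:
  assumes "P \<in> laurent_upto N"
  shows "Poly_Mapping.keys P \<subseteq> {- int N..int N}"
proof -
  from assms obtain c where P: "P = (\<Sum>j = - int N..int N. Poly_Mapping.single j (c j))"
    by (auto simp: laurent_upto_def laurent_scale_def mult_single)
  have "Poly_Mapping.keys P \<subseteq>
      (\<Union>j\<in>{- int N..int N}. Poly_Mapping.keys (Poly_Mapping.single j (c j)))"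
    unfolding P by (rule keys_sum)
  also have "\<dots> \<subseteq> {- int N..int N}"
    by (auto split: if_splits)
  finally show ?thesis .
qed

lemma poly_laurent_shift_poly:
  assumes "P \<in> laurent_upto N" and "z \<noteq> 0"
  shows "poly (laurent_shift_poly N P) z =
    (\<Sum>j\<in>Poly_Mapping.keys P. Poly_Mapping.lookup P j * z powi j) * z ^ N"
proof -
  have "z ^ nat (j + int N) = z powi j * z ^ N" if "j \<in> Poly_Mapping.keys P" for j
  proof -
    have "0 \<le> j + int N"
      using keys_laurent_upto[OF assms(1)] that by auto
    then have "z ^ nat (j + int N) = z powi (j + int N)"
      by (simp add: power_int_def)
    then show ?thesis
      using assms(2) by (simp add: power_int_add)
  qed
  then show ?thesis
    by (simp add: laurent_shift_poly_def poly_sum poly_monom sum_distrib_right mult.assoc)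
qed

definition finitely_atomic :: "complex measure \<Rightarrow> bool" where
  "finitely_atomic M \<longleftrightarrow> sets M = sets borel \<and>
     (\<exists>A w. finite A \<and> (\<forall>z\<in>A. 0 < w z) \<and>
       (\<forall>E\<in>sets borel. emeasure M E = (\<Sum>z\<in>A. ennreal (w z) * indicator E z)))"

end

theory Submission imports Defs "HOL-Library.Real_Mod" begin

text \<open>
  A Laurent polynomial in \<open>laurent_upto N\<close> is a combination of the monomials \<open>x powi (l - N)\<close> with
  \<open>0 \<le> l \<le> 2 * N\<close>, so the integral representation only asks for a positive measure whose moments
  \<open>\<integral>z ^ l d\<mu>\<close>, for these \<open>l\<close>, are the numbers \<open>s l = L (x powi (l - N)) / a\<close>. The choice of \<open>a\<close>
  gives \<open>s 0 = 1\<close>.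

  In the complex plane, unlike on the line or on the unit circle, positivity of \<open>\<mu>\<close> puts no
  constraint on finitely many such moments other than \<open>s 0 > 0\<close>: it concerns the mixed moments
  \<open>\<integral>z ^ k * cnj z ^ l d\<mu>\<close>, and those with \<open>k, l > 0\<close> are not prescribed; they can be made large
  by moving the mass away from the origin. Concretely, on a circle of radius \<open>R\<close>, the
  density \<open>1 + 2 * (\<Sum>j. Re (s j / z ^ j))\<close> with respect to the uniform distribution has the moments \<open>s 1, \<dots>, s m\<close>, because \<open>s j / z ^ j\<close> picks out the moment of order \<open>j\<close>
  while its conjugate, a multiple of \<open>z ^ j\<close>, integrates to \<open>0\<close> against every \<open>z ^ l\<close>.
  If \<open>R\<close> is large, the density is close to \<open>1\<close>, hence positive. Replacing the
  circle by sufficiently many equidistributed points keeps these orthogonality relations and makes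
  the measure finitely atomic. This is \<open>positive_atomic_moments\<close>; the orthogonality is
  \<open>sum_powi_nth_roots\<close>.
\<close>

section \<open>Power sums over the roots of a complex number\<close>

text \<open>Multiplication by a primitive root of unity permutes the roots and multiplies the sum by
  a factor other than \<open>1\<close>.\<close>

lemma sum_powi_nth_roots_eq_0:
  fixes c :: complex
  assumes "0 < n" and "c \<noteq> 0" and "\<not> int n dvd l"
  shows "(\<Sum>z | z ^ n = c. z powi l) = 0"
proof -
  define \<omega> where "\<omega> = cis (2 * pi / n)"
  have [simp]: "\<omega> \<noteq> 0"
    by (simp add: \<omega>_def)
  have \<omega>_pow: "\<omega> ^ n = 1"
    using assms(1) by (simp add: \<omega>_def Complex.DeMoivre)
  have "\<omega> powi l \<noteq> 1"
  proof
    assume "\<omega> powi l = 1"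
    then have "cis (of_int l * (2 * pi / n)) = 1"
      by (simp add: \<omega>_def cis_power_int)
    then obtain k where "of_int l * (2 * pi / n) = of_int k * (2 * pi)"
      unfolding cis_eq_1_iff by blast
    then have "real_of_int l = real_of_int (k * int n)"
      using assms(1) by (simp add: field_simps)
    then have "l = k * int n"
      by (simp only: of_int_eq_iff)
    with assms(3) show False
      by simp
  qed
  moreover have "bij_betw (\<lambda>z. \<omega> * z) {z. z ^ n = c} {z. z ^ n = c}"
    by (rule bij_betwI[where g = "\<lambda>z. z / \<omega>"])
      (auto simp: power_mult_distrib power_divide \<omega>_pow)
  then have "(\<Sum>z | z ^ n = c. z powi l) = (\<Sum>z | z ^ n = c. (\<omega> * z) powi l)"
    by (rule sum.reindex_bij_betw[symmetric])
  then have "(\<Sum>z | z ^ n = c. z powi l) = \<omega> powi l * (\<Sum>z | z ^ n = c. z powi l)"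
    unfolding power_int_mult_distrib sum_distrib_left[symmetric] .
  ultimately show ?thesis
    by simp
qed

lemma sum_powi_nth_roots:
  fixes c :: complex
  assumes "c \<noteq> 0" and "\<bar>l\<bar> < int n"
  shows "(\<Sum>z | z ^ n = c. z powi l) = (if l = 0 then of_nat n else 0)"
proof (cases "l = 0")
  case True
  then show ?thesis
    using assms card_nth_roots[of c n] by simp
next
  case False
  then have "\<not> int n dvd l"
    using assms(2) dvd_imp_le_int[of l "int n"] by auto
  then show ?thesis
    using False assms sum_powi_nth_roots_eq_0[of n c l] by simp
qed

section \<open>Truncated moment sequences of positive measures in the plane\<close>

text \<open>
  The atoms are the \<open>M\<close>-th roots of \<open>R ^ M\<close>, equidistributed on the circle of radius \<open>R\<close>. The
  products of \<open>z ^ l\<close> with the terms of the density have exponents \<open>l - j\<close>, \<open>l\<close> and \<open>l + j\<close>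
  between \<open>- m\<close> and \<open>2 * m\<close>; with \<open>M = 2 * m + 1\<close> atoms none of them except \<open>0\<close> is a
  multiple of \<open>M\<close>, so only the exponent \<open>0\<close> survives summation.
\<close>

lemma positive_atomic_moments:
  fixes s :: "nat \<Rightarrow> complex"
  assumes s_0: "s 0 = 1"
  shows "\<exists>A w. finite A \<and> (\<forall>z\<in>A. 0 < w z) \<and>
    (\<forall>l\<le>m. (\<Sum>z\<in>A. of_real (w z) * z ^ l) = s l)"
proof -
  \<comment> \<open>The terms of the density are bounded by \<open>2 * cmod (s j) / R\<close>, which sum to less than \<open>1\<close>.\<close>
  define R :: real where "R = 1 + 2 * (\<Sum>j=1..m. cmod (s j))"
  define M where "M = 2 * m + 1"
  define A where "A = {z::complex. z ^ M = of_real (R ^ M)}"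
  define w where "w z = (1 + 2 * (\<Sum>j=1..m. Re (s j * z powi - int j))) / M" for z
  have R: "1 \<le> R"
    using sum_nonneg[of "{1..m}" "\<lambda>j. cmod (s j)"] by (simp add: R_def)
  have "0 < M"
    by (simp add: M_def)
  have norm_A: "cmod z = R" if "z \<in> A" for z
  proof -
    have "cmod z ^ M = R ^ M"
      using that R unfolding A_def
      by (metis (mono_tags) abs_of_nonneg mem_Collect_eq norm_of_real norm_power order_trans
          zero_le_one zero_le_power)
    then show ?thesis
      using R \<open>0 < M\<close> by (metis norm_ge_zero order_trans power_eq_imp_eq_base zero_le_one)
  qed
  have "finite A"
    using \<open>0 < M\<close> by (auto simp: A_def)
  moreover have "0 < w z" if "z \<in> A" for z
  proof -
    have "\<bar>\<Sum>j=1..m. Re (s j * z powi - int j)\<bar> \<le> (\<Sum>j=1..m. cmod (s j) / R)"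
    proof (rule order_trans[OF sum_abs], rule sum_mono)
      fix j assume "j \<in> {1..m}"
      then have "R ^ 1 \<le> R ^ j"
        using R by (intro power_increasing) auto
      have "\<bar>Re (s j * z powi - int j)\<bar> \<le> cmod (s j) * cmod (z powi - int j)"
        by (metis abs_Re_le_cmod norm_mult)
      also have "cmod (z powi - int j) = 1 / R ^ j"
        using norm_A[OF that] by (simp add: norm_inverse norm_power power_int_minus divide_inverse)
      also have "cmod (s j) * (1 / R ^ j) \<le> cmod (s j) * (1 / R)"
        using \<open>R ^ 1 \<le> R ^ j\<close> R by (intro mult_left_mono divide_left_mono) auto
      finally show "\<bar>Re (s j * z powi - int j)\<bar> \<le> cmod (s j) / R"
        by simp
    qed
    also have "\<dots> < 1 / 2"
      using R by (simp add: sum_divide_distrib[symmetric] R_def field_simps)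
    finally have "0 < 1 + 2 * (\<Sum>j=1..m. Re (s j * z powi - int j))"
      by linarith
    then show ?thesis
      using \<open>0 < M\<close> by (simp add: w_def)
  qed
  moreover have "(\<Sum>z\<in>A. of_real (w z) * z ^ l) = s l" if "l \<le> m" for l
  proof -
    have power_sum: "(\<Sum>z\<in>A. z powi d) = (if d = 0 then of_nat M else 0)" if "\<bar>d\<bar> < int M" for d
      unfolding A_def using R that by (intro sum_powi_nth_roots) auto
    have expand: "of_nat M * (of_real (w z) * z ^ l) = z powi int l +
        (\<Sum>j=1..m. s j * z powi (int l - int j)) +
        (\<Sum>j=1..m. cnj (s j) / of_real R ^ (2 * j) * z powi (int l + int j))" if "z \<in> A" for z
    proof -
      have "z \<noteq> 0"
        using norm_A[OF that] R by auto
      \<comment> \<open>On the circle, the conjugate of \<open>1 / z\<close> is \<open>z / R\<^sup>2\<close>, so that the real part in the density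
        becomes a Laurent polynomial in \<open>z\<close>.\<close>
      have "z * cnj z = of_real R ^ 2"
        using norm_A[OF that] by (simp add: complex_norm_square[symmetric])
      then have "(z * cnj z) ^ j = of_real R ^ (2 * j)" for j
        by (simp add: power_mult)
      then have cnj_power: "cnj (z ^ j) * z ^ j = of_real R ^ (2 * j)" for j
        by (simp add: power_mult_distrib mult.commute)
      have cnj_powi: "cnj (z powi - int j) = z ^ j / of_real R ^ (2 * j)" for j
        using cnj_power[of j] \<open>z \<noteq> 0\<close> R by (simp add: power_int_minus field_simps)
      have "of_real (2 * Re (s j * z powi - int j)) * z ^ l =
          s j * z powi (int l - int j) +
          cnj (s j) / of_real R ^ (2 * j) * z powi (int l + int j)" for j
      proof -
        have "of_real (2 * Re (s j * z powi - int j)) =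
            s j * z powi - int j + cnj (s j) * (z ^ j / of_real R ^ (2 * j))"
          by (simp only: complex_add_cnj[symmetric] complex_cnj_mult cnj_powi)
        then show ?thesis
          using \<open>z \<noteq> 0\<close>
          by (simp add: power_int_diff power_int_add power_int_minus divide_inverse algebra_simps)
      qed
      then have terms: "(\<Sum>j=1..m. of_real (2 * Re (s j * z powi - int j)) * z ^ l) =
          (\<Sum>j=1..m. s j * z powi (int l - int j)) +
          (\<Sum>j=1..m. cnj (s j) / of_real R ^ (2 * j) * z powi (int l + int j))"
        by (simp only: sum.distrib)
      have "of_nat M * (of_real (w z) * z ^ l) =
          (1 + (\<Sum>j=1..m. of_real (2 * Re (s j * z powi - int j)))) * z ^ l"
        using \<open>0 < M\<close> by (simp add: w_def sum_distrib_left)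
      also have "\<dots> = z powi int l + (\<Sum>j=1..m. of_real (2 * Re (s j * z powi - int j)) * z ^ l)"
        by (simp only: distrib_right sum_distrib_right mult_1 power_int_of_nat)
      finally show ?thesis
        by (simp only: terms add.assoc)
    qed
    have "of_nat M * (\<Sum>z\<in>A. of_real (w z) * z ^ l) =
        (\<Sum>z\<in>A. z powi int l) +
        (\<Sum>j=1..m. s j * (\<Sum>z\<in>A. z powi (int l - int j))) +
        (\<Sum>j=1..m. cnj (s j) / of_real R ^ (2 * j) * (\<Sum>z\<in>A. z powi (int l + int j)))"
      by (simp only: sum_distrib_left expand sum.distrib sum.swap[of _ "{1..m}" A] cong: sum.cong)
    also have "(\<Sum>z\<in>A. z powi int l) = (if l = 0 then of_nat M else 0)"
      using that by (subst power_sum) (auto simp: M_def)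
    also have "(\<Sum>j=1..m. s j * (\<Sum>z\<in>A. z powi (int l - int j))) =
        (\<Sum>j=1..m. if l = j then s j * of_nat M else 0)"
      using that by (intro sum.cong refl, subst power_sum) (auto simp: M_def)
    also have "\<dots> = (if l = 0 then 0 else s l * of_nat M)"
      using that by auto
    also have "(\<Sum>j=1..m. cnj (s j) / of_real R ^ (2 * j) * (\<Sum>z\<in>A. z powi (int l + int j))) = 0"
      using that by (intro sum.neutral ballI, subst power_sum) (auto simp: M_def)
    finally show ?thesis
      using \<open>0 < M\<close> s_0 by (auto split: if_splits)
  qed
  ultimately show ?thesis
    by blast
qed

text \<open>\<open>point_measure\<close> carries the power set of \<open>A\<close> as its sigma-algebra; pushing it forward along
  the inclusion turns it into a Borel measure on the plane.\<close>

lemma atomic_measure: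
  fixes A :: "complex set" and w :: "complex \<Rightarrow> real"
  assumes "finite A" and w: "\<forall>z\<in>A. 0 < w z"
  shows "\<exists>\<mu>. finitely_atomic \<mu> \<and> (\<forall>h\<in>borel_measurable borel.
    integrable \<mu> h \<and> (\<integral>z. h z \<partial>\<mu>) = (\<Sum>z\<in>A. of_real (w z) * h z :: complex))"
proof (intro exI conjI ballI)
  let ?P = "point_measure A (\<lambda>z. ennreal (w z))"
  let ?\<mu> = "distr ?P borel id"
  have id: "id \<in> measurable ?P borel"
    by simp
  have "emeasure ?\<mu> E = (\<Sum>z\<in>A. ennreal (w z) * indicator E z)" if "E \<in> sets borel" for E
  proof -
    have "emeasure ?\<mu> E = emeasure ?P (E \<inter> A)"
      using that by (simp add: emeasure_distr[OF id] space_point_measure)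
    also have "\<dots> = (\<Sum>z\<in>E \<inter> A. ennreal (w z))"
      using assms(1) by (intro emeasure_point_measure_finite) auto
    also have "\<dots> = (\<Sum>z\<in>A. ennreal (w z) * indicator E z)"
      using assms(1) by (intro sum.mono_neutral_cong_left) (auto simp: indicator_def)
    finally show ?thesis .
  qed
  then show "finitely_atomic ?\<mu>"
    unfolding finitely_atomic_def using assms by (intro conjI exI[of _ A] exI[of _ w]) auto
  fix h :: "complex \<Rightarrow> complex"
  assume h: "h \<in> borel_measurable borel"
  show "integrable ?\<mu> h"
    using assms(1) by (simp add: integrable_distr_eq[OF id h] integrable_point_measure_finite)
  show "(\<integral>z. h z \<partial>?\<mu>) = (\<Sum>z\<in>A. of_real (w z) * h z)"
    using assms(1) w
    by (simp add: integral_distr[OF id h] lebesgue_integral_point_measure_finite less_imp_le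
        scaleR_conv_of_real)
qed

section \<open>Linear functionals on Laurent polynomials\<close>

lemma linear_functional_eq_sum_keys:
  assumes "Vector_Spaces.linear laurent_scale (*) L"
  shows "L P = (\<Sum>j\<in>Poly_Mapping.keys P. Poly_Mapping.lookup P j * L (laurent_X_powi j))"
proof -
  interpret Vector_Spaces.linear laurent_scale "(*)" L
    by (fact assms)
  have "P = (\<Sum>j\<in>Poly_Mapping.keys P.
      laurent_scale (Poly_Mapping.lookup P j) (laurent_X_powi j))"
    by (rule poly_mapping_eqI)
      (auto simp: laurent_scale_def mult_single lookup_sum lookup_single when_def in_keys_iff)
  then have "L P = L (\<Sum>j\<in>Poly_Mapping.keys P.
      laurent_scale (Poly_Mapping.lookup P j) (laurent_X_powi j))"
    by (rule arg_cong)
  then show ?thesis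
    by (simp add: sum scale)
qed

lemma laurent_X_powi_in_laurent_upto:
  assumes "j \<in> {- int N..int N}"
  shows "laurent_X_powi j \<in> laurent_upto N"
proof -
  have "laurent_X_powi j = (\<Sum>i = - int N..int N.
      laurent_scale (if i = j then 1 else 0) (laurent_X_powi i))"
    using assms
    by (intro poly_mapping_eqI)
      (auto simp: laurent_scale_def mult_single lookup_sum lookup_single when_def
        intro: sum.neutral)
  then show ?thesis
    unfolding laurent_upto_def by (intro image_eqI[where x = "\<lambda>i. if i = j then 1 else 0"]) simp_all
qed

theorem theorem3:
  fixes N :: nat
    and Q :: "int \<Rightarrow> laurent"
    and \<alpha> :: "int \<Rightarrow> int \<Rightarrow> complex"
    and g f :: "int \<Rightarrow> complex"
    and L L\<^sub>N :: "laurent \<Rightarrow> complex"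
    and a :: complex
  assumes "1 \<le> N"
    and Q_even: "\<And>n. n \<in> {0..int N} \<Longrightarrow>
      Q (2 * n) = (\<Sum>j = - n..n. laurent_scale (\<alpha> (2 * n) j) (laurent_X_powi j)) \<and>
      \<alpha> (2 * n) n \<noteq> 0"
    and Q_odd: "\<And>n. n \<in> {0..int N - 1} \<Longrightarrow>
      Q (2 * n + 1) =
        (\<Sum>j = - n - 1..n. laurent_scale (\<alpha> (2 * n + 1) j) (laurent_X_powi j)) \<and>
      \<alpha> (2 * n + 1) (- n - 1) \<noteq> 0"
    and Q_minus_1: "Q (- 1) = 0"
    and f_nonzero: "\<And>n. n \<in> {0..int N - 1} \<Longrightarrow> f (2 * n + 1) \<noteq> 0 \<and> f (2 * n + 2) \<noteq> 0"
    and rec_odd: "\<And>n. n \<in> {0..int N - 1} \<Longrightarrow>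
      Q (2 * n + 1) =
        (laurent_X_powi (- 1) + laurent_const (g (2 * n + 1))) * Q (2 * n)
        + laurent_scale (f (2 * n + 1)) (Q (2 * n - 1))"
    and rec_even: "\<And>n. n \<in> {0..int N - 1} \<Longrightarrow>
      Q (2 * n + 2) =
        (1 + laurent_scale (g (2 * n + 2)) (laurent_X_powi 1)) * Q (2 * n + 1)
        + laurent_scale (f (2 * n + 2)) (Q (2 * n))"
    and L_linear: "Vector_Spaces.linear laurent_scale (*) L"
    and L_orthogonal: "\<And>k m. k \<in> {0..2 * int N} \<Longrightarrow> m \<in> {0..2 * int N} \<Longrightarrow>
      (k \<noteq> m \<longrightarrow> L (Q k * Q m) = 0) \<and> (k = m \<longrightarrow> L (Q k * Q m) \<noteq> 0)"
    and L\<^sub>N_def: "L\<^sub>N = restrict L (laurent_upto N)"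
    and a_def: "a = L\<^sub>N (laurent_X_powi (- int N))"
    and "a \<noteq> 0"
  shows "\<exists>\<mu>. finitely_atomic \<mu> \<and>
    (\<forall>P\<in>laurent_upto N.
       integrable \<mu> (\<lambda>z. a * poly (laurent_shift_poly N P) z) \<and>
       L\<^sub>N P = (\<integral>z. a * poly (laurent_shift_poly N P) z \<partial>\<mu>))"
proof -
  define s where "s l = L (laurent_X_powi (int l - int N)) / a" for l
  have a_eq: "a = L (laurent_X_powi (- int N))"
    using laurent_X_powi_in_laurent_upto[of "- int N" N] by (simp add: a_def L\<^sub>N_def)
  have "s 0 = 1"
    using \<open>a \<noteq> 0\<close> by (simp add: s_def flip: a_eq)
  then obtain A w where "finite A" and w: "\<forall>z\<in>A. 0 < w z"
    and moments: "\<forall>l\<le>2 * N. (\<Sum>z\<in>A. of_real (w z) * z ^ l) = s l"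
    using positive_atomic_moments[of s "2 * N"] by blast
  obtain \<mu> where "finitely_atomic \<mu>"
    and integral: "\<forall>h\<in>borel_measurable borel.
      integrable \<mu> h \<and> (\<integral>z. h z \<partial>\<mu>) = (\<Sum>z\<in>A. of_real (w z) * h z :: complex)"
    using atomic_measure[OF \<open>finite A\<close> w] by blast
  have "integrable \<mu> (\<lambda>z. a * poly (laurent_shift_poly N P) z) \<and>
      L\<^sub>N P = (\<integral>z. a * poly (laurent_shift_poly N P) z \<partial>\<mu>)" if P: "P \<in> laurent_upto N" for P
  proof
    let ?c = "Poly_Mapping.lookup P" and ?K = "Poly_Mapping.keys P"
    have meas: "(\<lambda>z. a * poly (laurent_shift_poly N P) z) \<in> borel_measurable borel"
      by (intro borel_measurable_continuous_onI continuous_intros)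
    then show "integrable \<mu> (\<lambda>z. a * poly (laurent_shift_poly N P) z)"
      using integral by blast
    have "(\<integral>z. a * poly (laurent_shift_poly N P) z \<partial>\<mu>) =
        (\<Sum>z\<in>A. of_real (w z) * (a * poly (laurent_shift_poly N P) z))"
      using integral meas by blast
    also have "\<dots> = (\<Sum>z\<in>A. \<Sum>j\<in>?K. a * ?c j * (of_real (w z) * z ^ nat (j + int N)))"
      by (simp add: laurent_shift_poly_def poly_sum poly_monom sum_distrib_left mult_ac)
    also have "\<dots> = (\<Sum>j\<in>?K. a * ?c j * (\<Sum>z\<in>A. of_real (w z) * z ^ nat (j + int N)))"
      by (subst sum.swap) (simp only: sum_distrib_left)
    also have "\<dots> = (\<Sum>j\<in>?K. ?c j * L (laurent_X_powi j))"
    proof (rule sum.cong[OF refl])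
      fix j assume "j \<in> ?K"
      then have "j \<in> {- int N..int N}"
        using keys_laurent_upto[OF P] by blast
      then show "a * ?c j * (\<Sum>z\<in>A. of_real (w z) * z ^ nat (j + int N)) =
          ?c j * L (laurent_X_powi j)"
        using \<open>a \<noteq> 0\<close> by (subst moments[rule_format]) (auto simp: s_def)
    qed
    also have "\<dots> = L\<^sub>N P"
      using P by (simp add: L\<^sub>N_def flip: linear_functional_eq_sum_keys[OF L_linear])
    finally show "L\<^sub>N P = (\<integral>z. a * poly (laurent_shift_poly N P) z \<partial>\<mu>)"
      by simp
  qed
  with \<open>finitely_atomic \<mu>\<close> show ?thesis
    by blast
qed

end
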